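(* Let $X$ and $Y$ be nonempty locally compact Hausdorff spaces, let $r>0$, and let $H: B_{C_0(X)}(0;r)\to C_0(Y)$ be a bounded orthogonally additive and zero product preserving holomorphic function. Then there exist a sequence $\{h_n\}_{n\ge 1}$ of bounded scalar functions on $Y$, where for each $n$ the cozero set $\{y\in Y: h_n(y)\neq 0\}$ is open in $Y$ and $h_n$ is continuous on it, and a map $\varphi: Y\to X$ such that $$ H(f)(y) = \sum_{n=1}^\infty h_n(y)\,(f(\varphi(y)))^n, \quad \forall y\in Y, $$ uniformly for all $f$ in $B_{C_0(X)}(0;r)$. Moreover, $\varphi$ is continuous wherever some $h_n$ is nonvanishing, i.e. on $\bigcup_{n\ge1}\{y\in Y: h_n(y)\ne 0\}$.
   Context: $C_0(X)$ is the C*-algebra of continuous complex-valued functions on $X$ vanishing at infinity, with the sup norm. For a complex Banach space $E$, $B_E(0;r)$ is the open ball of radius $r>0$ centered at $0$. A bounded $n$-homogeneous polynomial $P:E\to F$ between complex Banach spaces is a map $P(x)=L(x,\dots,x)$ with $L:E\times\cdots\times E\to F$ a bounded symmetric $n$-linear operator. Holomorphic convention: a holomorphic function $H: B_E(0;r)\to F$ is one having, locally around each point, a uniformly convergent expansion in bounded homogeneous polynomials; as a standing convention, such an $H$ has its Taylor series at zero $H(x)=\sum_{n=0}^\infty P_n(x)$, with $P_n:E\to F$ bounded $n$-homogeneous polynomials ($P_0$ constant), converging uniformly for all $x\in B_E(0;r)$. $H$ is orthogonally additive if $H(f+g)=H(f)+H(g)$ whenever $fg=gf=0$, and zero product preserving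 if $H(f)H(g)=0$ whenever $fg=0$ (here $f,g$, and $f+g$ in the case of orthogonal additivity, range over the domain $B_{C_0(X)}(0;r)$). *)

theory Defs
  imports "HOL-Analysis.Analysis"
begin

text \<open>
  The distribution only has real normed spaces as type classes. A complex normed space is
  a real one with a compatible complex scalar multiplication.
\<close>

class scaleC =
  fixes scaleC :: "complex \<Rightarrow> 'a \<Rightarrow> 'a"  (infixr "*\<^sub>C" 75)

class complex_normed_vector = scaleC + real_normed_vector +
  assumes scaleC_add_right: "a *\<^sub>C (x + y) = a *\<^sub>C x + a *\<^sub>C y"
    and scaleC_add_left: "(a + b) *\<^sub>C x = a *\<^sub>C x + b *\<^sub>C x"
    and scaleC_scaleC: "a *\<^sub>C b *\<^sub>C x = (a * b) *\<^sub>C x"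
    and scaleC_of_real: "complex_of_real r *\<^sub>C x = r *\<^sub>R x"
    and norm_scaleC: "norm (a *\<^sub>C x) = cmod a * norm x"

class complex_banach = complex_normed_vector + banach

text \<open>
  An \<open>n\<close>-tuple is represented by a function on \<open>nat\<close> of which only the values at the indices
  \<open>i < n\<close> matter; this is the first conjunct. For \<open>n = 0\<close> such an operator is a constant.
\<close>

definition bounded_symmetric_multilinear ::
    "nat \<Rightarrow> ((nat \<Rightarrow> 'a::complex_banach) \<Rightarrow> 'b::complex_banach) \<Rightarrow> bool" where
  "bounded_symmetric_multilinear n L \<longleftrightarrow>
     (\<forall>x y. (\<forall>i<n. x i = y i) \<longrightarrow> L x = L y) \<and>
     (\<forall>i<n. \<forall>x u v. L (x(i := u + v)) = L (x(i := u)) + L (x(i := v))) \<and>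
     (\<forall>i<n. \<forall>x c u. L (x(i := c *\<^sub>C u)) = c *\<^sub>C L (x(i := u))) \<and>
     (\<forall>\<pi> x. \<pi> permutes {..<n} \<longrightarrow> L (x \<circ> \<pi>) = L x) \<and>
     (\<exists>C. \<forall>x. norm (L x) \<le> C * (\<Prod>i<n. norm (x i)))"

definition bounded_homogeneous_polynomial ::
    "nat \<Rightarrow> ('a::complex_banach \<Rightarrow> 'b::complex_banach) \<Rightarrow> bool" where
  "bounded_homogeneous_polynomial n P \<longleftrightarrow>
     (\<exists>L. bounded_symmetric_multilinear n L \<and> (\<forall>x. P x = L (\<lambda>_. x)))"

text \<open>
  Only the values of \<open>H\<close> on \<open>ball 0 r\<close> matter. The second conjunct is the standing convention
  that the Taylor series at zero converges uniformly on the whole ball.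
\<close>

definition holomorphic_on_zero_ball ::
    "real \<Rightarrow> ('a::complex_banach \<Rightarrow> 'b::complex_banach) \<Rightarrow> bool" where
  "holomorphic_on_zero_ball r H \<longleftrightarrow>
     (\<forall>a\<in>ball 0 r. \<exists>\<delta>>0. ball a \<delta> \<subseteq> ball 0 r \<and>
        (\<exists>Q. (\<forall>n. bounded_homogeneous_polynomial n (Q n)) \<and>
             uniform_limit (ball a \<delta>) (\<lambda>N x. \<Sum>n\<le>N. Q n (x - a)) H sequentially)) \<and>
     (\<exists>P. (\<forall>n. bounded_homogeneous_polynomial n (P n)) \<and>
          uniform_limit (ball 0 r) (\<lambda>N x. \<Sum>n\<le>N. P n x) H sequentially)"

definition orthogonally_additive_on ::
    "'a::{plus,times,zero} set \<Rightarrow> ('a \<Rightarrow> 'b::plus) \<Rightarrow> bool" where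
  "orthogonally_additive_on S H \<longleftrightarrow>
     (\<forall>f\<in>S. \<forall>g\<in>S. f + g \<in> S \<longrightarrow> f * g = 0 \<longrightarrow> g * f = 0 \<longrightarrow> H (f + g) = H f + H g)"

definition zero_product_preserving_on ::
    "'a::{times,zero} set \<Rightarrow> ('a \<Rightarrow> 'b::{times,zero}) \<Rightarrow> bool" where
  "zero_product_preserving_on S H \<longleftrightarrow>
     (\<forall>f\<in>S. \<forall>g\<in>S. f * g = 0 \<longrightarrow> H f * H g = 0)"

definition vanishes_at_infinity :: "('a::topological_space \<Rightarrow> complex) \<Rightarrow> bool" where
  "vanishes_at_infinity f \<longleftrightarrow> (\<forall>e>0. \<exists>K. compact K \<and> (\<forall>x. x \<notin> K \<longrightarrow> cmod (f x) < e))"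

typedef (overloaded) ('a::topological_space) c0 =
    "{f :: 'a \<Rightarrow> complex. continuous_on UNIV f \<and> vanishes_at_infinity f}"
  morphisms apply_c0 Abs_c0
proof
  show "(\<lambda>_. 0) \<in> {f :: 'a \<Rightarrow> complex. continuous_on UNIV f \<and> vanishes_at_infinity f}"
    by (auto simp: vanishes_at_infinity_def intro!: exI[of _ "{}"])
qed

setup_lifting type_definition_c0

lemma vanishes_at_infinity_add:
  assumes "vanishes_at_infinity f" "vanishes_at_infinity g"
  shows "vanishes_at_infinity (\<lambda>x. f x + g x)"
  unfolding vanishes_at_infinity_def
proof (intro allI impI)
  fix e :: real assume "e > 0"
  then have e: "e/2 > 0" by simp
  obtain K where K: "compact K" "\<And>x. x \<notin> K \<Longrightarrow> cmod (f x) < e/2"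
    using assms(1) e unfolding vanishes_at_infinity_def by blast
  obtain L where L: "compact L" "\<And>x. x \<notin> L \<Longrightarrow> cmod (g x) < e/2"
    using assms(2) e unfolding vanishes_at_infinity_def by blast
  have "cmod (f x + g x) < e" if "x \<notin> K \<union> L" for x
    using K(2)[of x] L(2)[of x] that norm_triangle_ineq[of "f x" "g x"] by auto
  then show "\<exists>K. compact K \<and> (\<forall>x. x \<notin> K \<longrightarrow> cmod (f x + g x) < e)"
    using compact_Un[OF K(1) L(1)] by blast
qed

lemma vanishes_at_infinity_bound:
  assumes "vanishes_at_infinity f" "\<And>x. cmod (g x) \<le> C * cmod (f x)"
  shows "vanishes_at_infinity g"
  unfolding vanishes_at_infinity_def
proof (intro allI impI)
  fix e :: real assume "e > 0"
  then have e: "e / (\<bar>C\<bar> + 1) > 0" by (simp add: add_nonneg_pos)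
  obtain K where K: "compact K" "\<And>x. x \<notin> K \<Longrightarrow> cmod (f x) < e / (\<bar>C\<bar> + 1)"
    using assms(1) e unfolding vanishes_at_infinity_def by blast
  have "cmod (g x) < e" if "x \<notin> K" for x
  proof -
    have "cmod (g x) \<le> C * cmod (f x)" by (rule assms(2))
    also have "\<dots> \<le> (\<bar>C\<bar> + 1) * cmod (f x)" by (intro mult_right_mono) auto
    also have "\<dots> < e"
      using K(2)[OF that] by (simp add: pos_less_divide_eq add_nonneg_pos mult.commute)
    finally show ?thesis .
  qed
  then show "\<exists>K. compact K \<and> (\<forall>x. x \<notin> K \<longrightarrow> cmod (g x) < e)"
    using K(1) by blast
qed

lemma vanishes_at_infinity_bounded:
  assumes "continuous_on UNIV f" "vanishes_at_infinity f"
  shows "bounded (range f)"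
proof -
  obtain K where K: "compact K" "\<And>x. x \<notin> K \<Longrightarrow> cmod (f x) < 1"
    using assms(2) unfolding vanishes_at_infinity_def by (meson zero_less_one)
  have "bounded (f ` K)"
    by (intro compact_imp_bounded compact_continuous_image K(1)
        continuous_on_subset[OF assms(1)]) auto
  then obtain M where M: "\<And>x. x \<in> K \<Longrightarrow> cmod (f x) \<le> M"
    by (auto simp: bounded_iff)
  have "cmod (f x) \<le> max M 1" for x
    using M[of x] K(2)[of x] by (cases "x \<in> K") auto
  then show ?thesis by (auto simp: bounded_iff)
qed

lemma vanishes_at_infinity_diff:
  assumes "vanishes_at_infinity f" "vanishes_at_infinity g"
  shows "vanishes_at_infinity (\<lambda>x. f x - g x)"
proof -
  have "vanishes_at_infinity (\<lambda>x. - g x)"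
    by (rule vanishes_at_infinity_bound[OF assms(2), where C=1]) simp
  then show ?thesis
    using vanishes_at_infinity_add[OF assms(1), of "\<lambda>x. - g x"] by simp
qed

lemma vanishes_at_infinity_mult:
  assumes "continuous_on UNIV f" "vanishes_at_infinity f" "vanishes_at_infinity g"
  shows "vanishes_at_infinity (\<lambda>x. f x * g x)"
proof -
  obtain M where M: "\<And>x. cmod (f x) \<le> M"
    using vanishes_at_infinity_bounded[OF assms(1,2)] by (auto simp: bounded_iff)
  show ?thesis
    by (rule vanishes_at_infinity_bound[OF assms(3), where C=M])
      (simp add: norm_mult mult_right_mono M)
qed

instantiation c0 :: (topological_space) comm_ring
begin

lift_definition zero_c0 :: "'a c0" is "\<lambda>_. 0"
  by (auto simp: vanishes_at_infinity_def intro!: exI[of _ "{}"])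

lift_definition plus_c0 :: "'a c0 \<Rightarrow> 'a c0 \<Rightarrow> 'a c0" is "\<lambda>f g x. f x + g x"
  by (auto intro!: continuous_intros vanishes_at_infinity_add)

lift_definition uminus_c0 :: "'a c0 \<Rightarrow> 'a c0" is "\<lambda>f x. - f x"
  by (auto intro!: continuous_intros elim!: vanishes_at_infinity_bound[where C=1])

lift_definition minus_c0 :: "'a c0 \<Rightarrow> 'a c0 \<Rightarrow> 'a c0" is "\<lambda>f g x. f x - g x"
  by (auto intro!: continuous_intros vanishes_at_infinity_diff)

lift_definition times_c0 :: "'a c0 \<Rightarrow> 'a c0 \<Rightarrow> 'a c0" is "\<lambda>f g x. f x * g x"
  by (auto intro!: continuous_intros vanishes_at_infinity_mult)

instance
  by standard (transfer; simp add: fun_eq_iff algebra_simps)+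

end

lemma bdd_above_c0: "bdd_above (range (\<lambda>x. cmod (apply_c0 f x)))"
proof -
  obtain M where "\<And>x. cmod (apply_c0 f x) \<le> M"
    using vanishes_at_infinity_bounded[of "apply_c0 f"] apply_c0[of f]
    by (auto simp: bounded_iff)
  then show ?thesis by (auto intro!: bdd_aboveI[of _ M])
qed

instantiation c0 :: (topological_space) complex_normed_vector
begin

lift_definition scaleC_c0 :: "complex \<Rightarrow> 'a c0 \<Rightarrow> 'a c0" is "\<lambda>c f x. c * f x"
  by (auto intro!: continuous_intros elim!: vanishes_at_infinity_bound simp: norm_mult)

definition scaleR_c0 :: "real \<Rightarrow> 'a c0 \<Rightarrow> 'a c0" where
  "scaleR_c0 r f = complex_of_real r *\<^sub>C f"

definition norm_c0 :: "'a c0 \<Rightarrow> real" where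
  "norm_c0 f = (SUP x. cmod (apply_c0 f x))"

definition sgn_c0 :: "'a c0 \<Rightarrow> 'a c0" where
  "sgn_c0 f = inverse (norm f) *\<^sub>R f"

definition dist_c0 :: "'a c0 \<Rightarrow> 'a c0 \<Rightarrow> real" where
  "dist_c0 f g = norm (f - g)"

definition uniformity_c0 :: "('a c0 \<times> 'a c0) filter" where
  "uniformity_c0 = (INF e\<in>{0 <..}. principal {(f, g). dist f g < e})"

definition open_c0 :: "'a c0 set \<Rightarrow> bool" where
  "open_c0 S = (\<forall>f\<in>S. \<forall>\<^sub>F (f', g) in uniformity. f' = f \<longrightarrow> g \<in> S)"

lemma norm_apply_c0_le: "cmod (apply_c0 f x) \<le> norm f"
  unfolding norm_c0_def by (rule cSUP_upper[OF UNIV_I bdd_above_c0])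

lemma norm_c0_le: "(\<And>x. cmod (apply_c0 f x) \<le> b) \<Longrightarrow> norm f \<le> b"
  unfolding norm_c0_def by (rule cSUP_least) auto

instance
proof
  fix f g :: "'a c0" and a b :: complex and r s :: real and S :: "'a c0 set"
  show scale1: "a *\<^sub>C (f + g) = a *\<^sub>C f + a *\<^sub>C g"
    by transfer (simp add: fun_eq_iff algebra_simps)
  show scale2: "(a + b) *\<^sub>C f = a *\<^sub>C f + b *\<^sub>C f"
    by transfer (simp add: fun_eq_iff algebra_simps)
  show scale3: "a *\<^sub>C b *\<^sub>C f = (a * b) *\<^sub>C f"
    by transfer (simp add: fun_eq_iff algebra_simps)
  show "complex_of_real r *\<^sub>C f = r *\<^sub>R f"
    by (simp add: scaleR_c0_def)
  show normC: "norm (a *\<^sub>C f) = cmod a * norm f" for a :: complex and f :: "'a c0"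
  proof (rule antisym)
    show le: "norm (a *\<^sub>C f) \<le> cmod a * norm f" for a :: complex and f :: "'a c0"
      by (rule norm_c0_le)
        (simp add: scaleC_c0.rep_eq norm_mult mult_left_mono norm_apply_c0_le)
    show "cmod a * norm f \<le> norm (a *\<^sub>C f)"
    proof (cases "a = 0")
      case True
      have "0 \<le> norm (a *\<^sub>C f)"
        using norm_apply_c0_le[of "a *\<^sub>C f"] norm_ge_zero order_trans by blast
      with True show ?thesis by simp
    next
      case False
      have "inverse a *\<^sub>C a *\<^sub>C f = f"
        using False by transfer (simp add: fun_eq_iff)
      then have "norm f \<le> inverse (cmod a) * norm (a *\<^sub>C f)"
        using le[of "inverse a" "a *\<^sub>C f"] by (simp add: norm_inverse)
      then show ?thesis using False by (simp add: field_simps)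
    qed
  qed
  show "r *\<^sub>R (f + g) = r *\<^sub>R f + r *\<^sub>R g" "(r + s) *\<^sub>R f = r *\<^sub>R f + s *\<^sub>R f"
       "r *\<^sub>R s *\<^sub>R f = (r * s) *\<^sub>R f" "1 *\<^sub>R f = f"
    unfolding scaleR_c0_def by (transfer; simp add: fun_eq_iff algebra_simps)+
  show "dist f g = norm (f - g)" by (rule dist_c0_def)
  show "sgn f = inverse (norm f) *\<^sub>R f" by (rule sgn_c0_def)
  show "uniformity = (INF e\<in>{0 <..}. principal {(f, g :: 'a c0). dist f g < e})"
    by (rule uniformity_c0_def)
  show "open S = (\<forall>f\<in>S. \<forall>\<^sub>F (f', g) in uniformity. f' = f \<longrightarrow> g \<in> S)"
    by (rule open_c0_def)
  show "norm f = 0 \<longleftrightarrow> f = 0"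
  proof
    assume "norm f = 0"
    then have "apply_c0 f x = 0" for x using norm_apply_c0_le[of f x] by simp
    then show "f = 0" by (simp add: apply_c0_inject[symmetric] zero_c0.rep_eq fun_eq_iff)
  next
    assume "f = 0"
    then show "norm f = 0" by (simp add: norm_c0_def zero_c0.rep_eq)
  qed
  show "norm (f + g) \<le> norm f + norm g"
    by (rule norm_c0_le)
      (auto simp: plus_c0.rep_eq intro!: norm_triangle_le add_mono norm_apply_c0_le)
  show "norm (r *\<^sub>R f) = \<bar>r\<bar> * norm f"
    by (simp add: scaleR_c0_def normC)
qed

end

instance c0 :: (topological_space) real_normed_algebra
proof
  fix f g :: "'a c0" and r :: real
  show "r *\<^sub>R f * g = r *\<^sub>R (f * g)" "f * r *\<^sub>R g = r *\<^sub>R (f * g)"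
    unfolding scaleR_c0_def by (transfer; simp add: fun_eq_iff algebra_simps)+
  show "norm (f * g) \<le> norm f * norm g"
    by (rule norm_c0_le)
      (auto simp: times_c0.rep_eq norm_mult intro!: mult_mono norm_apply_c0_le)
qed

instance c0 :: (topological_space) complex_banach
proof
  fix X :: "nat \<Rightarrow> 'a c0" assume X: "Cauchy X"
  have "uniformly_Cauchy_on UNIV (\<lambda>n. apply_c0 (X n))"
    unfolding uniformly_Cauchy_on_def
  proof (intro allI impI)
    fix e :: real assume "e > 0"
    then obtain M where M: "\<And>m n. m \<ge> M \<Longrightarrow> n \<ge> M \<Longrightarrow> norm (X m - X n) < e"
      using X unfolding Cauchy_iff by blast
    have "dist (apply_c0 (X m) x) (apply_c0 (X n) x) < e" if "m \<ge> M" "n \<ge> M" for m n x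
      using norm_apply_c0_le[of "X m - X n" x] M[OF that]
      by (simp add: dist_norm minus_c0.rep_eq)
    then show "\<exists>M. \<forall>x\<in>UNIV. \<forall>m\<ge>M. \<forall>n\<ge>M. dist (apply_c0 (X m) x) (apply_c0 (X n) x) < e"
      by blast
  qed
  then obtain g where g: "uniform_limit UNIV (\<lambda>n. apply_c0 (X n)) g sequentially"
    using Cauchy_uniformly_convergent uniformly_convergent_on_def by blast
  have "continuous_on UNIV (apply_c0 (X n))" for n
    using apply_c0[of "X n"] by simp
  then have cont: "continuous_on UNIV g"
    by (intro uniform_limit_theorem[OF _ g]) auto
  have close: "\<exists>N. \<forall>n\<ge>N. \<forall>x. cmod (apply_c0 (X n) x - g x) < e" if "e > 0" for e
    using uniform_limitD[OF g that] by (auto simp: eventually_sequentially dist_norm)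
  have van: "vanishes_at_infinity g"
    unfolding vanishes_at_infinity_def
  proof (intro allI impI)
    fix e :: real assume "e > 0"
    then have e: "e/2 > 0" by simp
    obtain n where n: "\<And>x. cmod (apply_c0 (X n) x - g x) < e/2"
      using close[OF e] by blast
    obtain K where K: "compact K" "\<And>x. x \<notin> K \<Longrightarrow> cmod (apply_c0 (X n) x) < e/2"
      using apply_c0[of "X n"] e unfolding vanishes_at_infinity_def by blast
    have "cmod (g x) < e" if "x \<notin> K" for x
      using n[of x] K(2)[OF that] norm_triangle_sub[of "g x" "apply_c0 (X n) x"]
      by (simp add: norm_minus_commute)
    with K(1) show "\<exists>K. compact K \<and> (\<forall>x. x \<notin> K \<longrightarrow> cmod (g x) < e)" by blast
  qed
  define G where "G = Abs_c0 g"
  have G: "apply_c0 G = g"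
    unfolding G_def using cont van by (simp add: Abs_c0_inverse)
  have "X \<longlonglongrightarrow> G"
  proof (rule LIMSEQ_I)
    fix e :: real assume "e > 0"
    then have e: "e/2 > 0" by simp
    obtain N where N: "\<And>n x. n \<ge> N \<Longrightarrow> cmod (apply_c0 (X n) x - g x) < e/2"
      using close[OF e] by blast
    have "norm (X n - G) < e" if "n \<ge> N" for n
    proof -
      have "norm (X n - G) \<le> e/2"
        using N[OF that] by (intro norm_c0_le) (simp add: minus_c0.rep_eq G less_imp_le)
      then show ?thesis using \<open>e > 0\<close> by simp
    qed
    then show "\<exists>N. \<forall>n\<ge>N. norm (X n - G) < e" by blast
  qed
  then show "convergent X" by (auto simp: convergent_def)
qed

end

theory Submission
  imports Defs
begin

text \<open>
  Fix \<open>y\<close>. Comparing coefficients of power series in a scalar parameter transfers both hypotheses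
  from \<open>H\<close> to its Taylor terms: \<open>p\<^sub>n f = P\<^sub>n f y\<close> is an orthogonally additive scalar polynomial, and
  \<open>p\<^sub>m f = 0\<close> or \<open>p\<^sub>n g = 0\<close> whenever \<open>f g = 0\<close>. By polarization, the symmetric form \<open>L\<close> behind \<open>p\<^sub>n\<close>
  vanishes if its arguments fall into two nonempty groups with disjoint supports; cutting the
  other arguments with Urysohn functions, it vanishes as soon as two of them have disjoint compact
  supports. This locality gives \<open>L f\<^sub>1 \<dots> f\<^sub>n = 0\<close> if some \<open>f\<^sub>i\<close> vanishes at all points without an open
  neighbourhood on which every \<open>p\<^sub>n\<close> is null. By the zero product condition there is at most one
  such point \<open>\<phi> y\<close>. So \<open>f\<close> may be replaced by \<open>f (\<phi> y) \<sqdot> e\<close> in each argument, where \<open>e (\<phi> y) = 1\<close>,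
  and \<open>p\<^sub>n f = p\<^sub>n e \<sqdot> f (\<phi> y)\<^sup>n\<close>.
\<close>

section \<open>Power series and polarization\<close>

lemma power_series_coeff_zero:
  fixes a :: "nat \<Rightarrow> complex"
  assumes "\<And>t. norm t \<le> 1 \<Longrightarrow> (\<lambda>n. a n * t ^ n) sums 0"
  shows "a n = 0"
proof -
  have "conv_radius a \<ge> norm (1 :: complex)"
    using assms[of 1] by (intro conv_radius_geI) (auto simp: sums_iff)
  then have pos: "fps_conv_radius (Abs_fps a) > 0"
    by (auto simp: fps_conv_radius_def one_ereal_def intro: less_le_trans[of _ "ereal 1"])
  have "eval_fps (Abs_fps a) t = eval_fps 0 t" if "norm t \<le> 1" for t
    using assms[OF that] by (simp add: eval_fps_def sums_iff)
  moreover have "\<forall>\<^sub>F t in nhds (0::complex). norm t \<le> 1"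
    using eventually_nhds_in_open[of "ball (0::complex) 1" 0] by (auto elim: eventually_mono)
  ultimately have "Abs_fps a = 0"
    using pos by (intro eval_fps_eqD) (auto elim: eventually_mono)
  then show ?thesis
    by (metis fps_nth_Abs_fps fps_zero_nth)
qed

lemma alternating_sum_Pow_eq_0:
  fixes F :: "'a set \<Rightarrow> 'b::comm_ring_1"
  assumes "finite N" "j \<in> N" "\<And>A. A \<subseteq> N - {j} \<Longrightarrow> F (insert j A) = F A"
  shows "(\<Sum>A\<in>Pow N. (-1) ^ card A * F A) = 0"
proof -
  define M where "M = N - {j}"
  have N: "N = insert j M" "j \<notin> M" "finite M"
    using assms by (auto simp: M_def)
  have inj: "inj_on (insert j) (Pow M)"
    using N(2) by (auto simp: inj_on_def)
  have "(\<Sum>A\<in>Pow N. (-1) ^ card A * F A)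
      = (\<Sum>A\<in>Pow M. (-1) ^ card A * F A) + (\<Sum>A\<in>insert j ` Pow M. (-1) ^ card A * F A)"
    unfolding N(1) Pow_insert using N by (intro sum.union_disjoint) auto
  also have "(\<Sum>A\<in>insert j ` Pow M. (-1) ^ card A * F A)
      = (\<Sum>A\<in>Pow M. - ((-1) ^ card A * F A))"
    unfolding sum.reindex[OF inj] o_def
  proof (rule sum.cong)
    fix A assume A: "A \<in> Pow M"
    then have "j \<notin> A" "finite A" using N finite_subset by auto
    then show "(-1) ^ card (insert j A) * F (insert j A) = - ((-1) ^ card A * F A)"
      using assms(3)[of A] A by (simp add: M_def)
  qed auto
  finally show ?thesis by (simp add: sum_negf)
qed

locale symmetric_additive_form =
  fixes n :: nat and L :: "(nat \<Rightarrow> 'a::ab_group_add) \<Rightarrow> complex"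
  assumes slots_cong: "(\<And>i. i < n \<Longrightarrow> x i = y i) \<Longrightarrow> L x = L y"
    and add_slot: "i < n \<Longrightarrow> L (x(i := u + v)) = L (x(i := u)) + L (x(i := v))"
    and symmetric: "\<pi> permutes {..<n} \<Longrightarrow> L (x \<circ> \<pi>) = L x"
begin

lemma zero_slot: "i < n \<Longrightarrow> L (x(i := 0)) = 0"
  using add_slot[of i x 0 0] by simp

lemma sum_slot:
  "finite A \<Longrightarrow> i < n \<Longrightarrow> L (x(i := (\<Sum>j\<in>A. v j))) = (\<Sum>j\<in>A. L (x(i := v j)))"
  by (induction A rule: finite_induct) (auto simp: zero_slot add_slot)

lemma sum_slots:
  assumes "finite A" "m \<le> n"
  shows "L (\<lambda>i. if i < m then (\<Sum>j\<in>A. v j) else z i)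
       = (\<Sum>k\<in>{..<m} \<rightarrow>\<^sub>E A. L (\<lambda>i. if i < m then v (k i) else z i))"
  using assms(2)
proof (induction m arbitrary: z)
  case 0
  then show ?case by simp
next
  case (Suc m)
  let ?s = "\<Sum>j\<in>A. v j"
  let ?y = "\<lambda>k i. if i < m then v (k i) else z i"
  have upd: "(?y k)(m := v j) = (\<lambda>i. if i < Suc m then v ((k(m := j)) i) else z i)" for k j
    by (auto simp: fun_eq_iff less_Suc_eq)
  have "L (\<lambda>i. if i < Suc m then ?s else z i) = L (\<lambda>i. if i < m then ?s else (z(m := ?s)) i)"
    by (intro slots_cong) auto
  also have "\<dots> = (\<Sum>k\<in>{..<m} \<rightarrow>\<^sub>E A. L (\<lambda>i. if i < m then v (k i) else (z(m := ?s)) i))"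
    using Suc.prems by (intro Suc.IH) auto
  also have "\<dots> = (\<Sum>k\<in>{..<m} \<rightarrow>\<^sub>E A. L ((?y k)(m := ?s)))"
    by (intro sum.cong refl slots_cong) auto
  also have "\<dots> = (\<Sum>k\<in>{..<m} \<rightarrow>\<^sub>E A. \<Sum>j\<in>A. L ((?y k)(m := v j)))"
    using Suc.prems assms(1) by (intro sum.cong refl sum_slot) auto
  also have "\<dots> = (\<Sum>j\<in>A. \<Sum>k\<in>{..<m} \<rightarrow>\<^sub>E A. L ((?y k)(m := v j)))"
    by (rule sum.swap)
  also have "\<dots> = (\<Sum>(j, k)\<in>A \<times> ({..<m} \<rightarrow>\<^sub>E A). L ((?y k)(m := v j)))"
    by (rule sum.cartesian_product)
  also have "\<dots> = (\<Sum>(j, k)\<in>A \<times> ({..<m} \<rightarrow>\<^sub>E A).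
      L (\<lambda>i. if i < Suc m then v ((k(m := j)) i) else z i))"
    by (simp only: upd)
  also have "\<dots> = (\<Sum>k\<in>{..<Suc m} \<rightarrow>\<^sub>E A. L (\<lambda>i. if i < Suc m then v (k i) else z i))"
  proof -
    have "m \<notin> {..<m}" by simp
    from sum.reindex[OF inj_combinator[OF this, of "\<lambda>_. A"],
        of "\<lambda>k. L (\<lambda>i. if i < Suc m then v (k i) else z i)"]
    show ?thesis
      unfolding lessThan_Suc PiE_insert_eq by (simp add: case_prod_unfold o_def)
  qed
  finally show ?case .
qed

lemma polarization:
  "\<exists>c. c \<noteq> 0 \<and> (\<forall>x. (\<Sum>A\<in>Pow {..<n}. (-1) ^ card A * L (\<lambda>_. \<Sum>j\<in>A. x j)) = c * L x)"
proof -
  define N where "N = {..<n}"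
  define S where "S = {k \<in> N \<rightarrow>\<^sub>E N. k ` N = N}"
  have fin: "finite N" "finite (N \<rightarrow>\<^sub>E N)" by (auto simp: N_def intro!: finite_PiE)
  then have "finite S" by (auto simp: S_def)
  moreover have "restrict id N \<in> S" by (auto simp: S_def)
  ultimately have card: "card S \<noteq> 0" by auto
  have main: "(\<Sum>A\<in>Pow N. (-1) ^ card A * L (\<lambda>_. \<Sum>j\<in>A. x j)) = ((-1) ^ n * of_nat (card S)) * L x"
    for x
  proof -
    have "(\<Sum>A\<in>Pow N. (-1) ^ card A * L (\<lambda>_. \<Sum>j\<in>A. x j))
        = (\<Sum>A\<in>Pow N. \<Sum>k\<in>N \<rightarrow>\<^sub>E N. (-1) ^ card A * ((if k ` N \<subseteq> A then 1 else 0) * L (x \<circ> k)))"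
    proof (rule sum.cong[OF refl])
      fix A assume A: "A \<in> Pow N"
      then have finA: "finite A" using fin finite_subset by auto
      have "L (\<lambda>_. \<Sum>j\<in>A. x j) = L (\<lambda>i. if i < n then \<Sum>j\<in>A. x j else 0)"
        by (intro slots_cong) auto
      also have "\<dots> = (\<Sum>k\<in>N \<rightarrow>\<^sub>E A. L (\<lambda>i. if i < n then x (k i) else 0))"
        unfolding N_def by (rule sum_slots[OF finA]) auto
      also have "\<dots> = (\<Sum>k\<in>N \<rightarrow>\<^sub>E A. L (x \<circ> k))"
        by (intro sum.cong refl slots_cong) auto
      also have "N \<rightarrow>\<^sub>E A = {k \<in> N \<rightarrow>\<^sub>E N. k ` N \<subseteq> A}"
        using A by (auto simp: PiE_def)
      also have "(\<Sum>k\<in>\<dots>. L (x \<circ> k)) = (\<Sum>k\<in>N \<rightarrow>\<^sub>E N. (if k ` N \<subseteq> A then 1 else 0) * L (x \<circ> k))"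
        using fin by (subst sum.inter_filter) (auto intro!: sum.cong)
      finally show "(-1) ^ card A * L (\<lambda>_. \<Sum>j\<in>A. x j)
          = (\<Sum>k\<in>N \<rightarrow>\<^sub>E N. (-1) ^ card A * ((if k ` N \<subseteq> A then 1 else 0) * L (x \<circ> k)))"
        by (simp add: sum_distrib_left)
    qed
    also have "\<dots> = (\<Sum>k\<in>N \<rightarrow>\<^sub>E N. \<Sum>A\<in>Pow N. (-1) ^ card A * ((if k ` N \<subseteq> A then 1 else 0) * L (x \<circ> k)))"
      by (rule sum.swap)
    also have "\<dots> = (\<Sum>k\<in>N \<rightarrow>\<^sub>E N. if k ` N = N then (-1) ^ n * L x else 0)"
    proof (rule sum.cong[OF refl])
      fix k assume k: "k \<in> N \<rightarrow>\<^sub>E N"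
      show "(\<Sum>A\<in>Pow N. (-1) ^ card A * ((if k ` N \<subseteq> A then 1 else 0) * L (x \<circ> k)))
          = (if k ` N = N then (-1) ^ n * L x else 0)"
      proof (cases "k ` N = N")
        case True
        then have "inj_on k N" using fin by (simp add: finite_surj_inj)
        then have "bij_betw k N N" using True by (simp add: bij_betw_def)
        then have "bij_betw (\<lambda>i. if i \<in> N then k i else i) N N"
          by (subst bij_betw_cong[where g=k]) auto
        then have perm: "(\<lambda>i. if i \<in> N then k i else i) permutes {..<n}"
          unfolding N_def by (intro bij_imp_permutes) auto
        have "L (x \<circ> k) = L (x \<circ> (\<lambda>i. if i \<in> N then k i else i))"
          by (intro slots_cong) (auto simp: N_def)
        also have "\<dots> = L x" by (rule symmetric[OF perm])
        finally have "L (x \<circ> k) = L x" .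
        moreover have "(\<Sum>A\<in>Pow N. (-1) ^ card A * ((if k ` N \<subseteq> A then 1 else 0) * L (x \<circ> k)))
            = (\<Sum>A\<in>{N}. (-1) ^ card A * ((if k ` N \<subseteq> A then 1 else 0) * L (x \<circ> k)))"
          using True fin by (intro sum.mono_neutral_right) auto
        ultimately show ?thesis using True by (simp add: N_def)
      next
        case False
        then obtain j where "j \<in> N" "j \<notin> k ` N" using k by (auto simp: PiE_def)
        then show ?thesis
          using False fin by (subst alternating_sum_Pow_eq_0[where j=j]) auto
      qed
    qed
    also have "\<dots> = (\<Sum>k\<in>S. (-1) ^ n * L x)"
      unfolding S_def using fin by (subst sum.inter_filter) auto
    finally show ?thesis by simp
  qed
  then show ?thesis
    using card unfolding N_def by (intro exI[of _ "(-1) ^ n * of_nat (card S)"]) auto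
qed

lemma zero_if_diagonal_zero:
  assumes "\<And>A. A \<subseteq> {..<n} \<Longrightarrow> L (\<lambda>_. \<Sum>j\<in>A. x j) = 0"
  shows "L x = 0"
proof -
  have "(\<Sum>A\<in>Pow {..<n}. (-1) ^ card A * L (\<lambda>_. \<Sum>j\<in>A. x j)) = 0"
    using assms by (intro sum.neutral) auto
  then show ?thesis using polarization by auto
qed

lemma zero_if_diagonal_splits:
  assumes I: "I \<subseteq> {..<n}" "I \<noteq> {}" "I \<noteq> {..<n}"
    and split: "\<And>A. A \<subseteq> {..<n} \<Longrightarrow>
      L (\<lambda>_. \<Sum>j\<in>A. x j) = L (\<lambda>_. \<Sum>j\<in>A \<inter> I. x j) + L (\<lambda>_. \<Sum>j\<in>A - I. x j)"
  shows "L x = 0"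
proof -
  obtain i j where ij: "i \<in> I" "i < n" "j \<notin> I" "j < n" using I by blast
  have "(\<Sum>A\<in>Pow {..<n}. (-1) ^ card A * L (\<lambda>_. \<Sum>j\<in>A. x j))
      = (\<Sum>A\<in>Pow {..<n}. (-1) ^ card A * L (\<lambda>_. \<Sum>j\<in>A \<inter> I. x j))
      + (\<Sum>A\<in>Pow {..<n}. (-1) ^ card A * L (\<lambda>_. \<Sum>j\<in>A - I. x j))"
    by (simp add: split sum.distrib[symmetric] ring_distribs[symmetric])
  also have "(\<Sum>A\<in>Pow {..<n}. (-1) ^ card A * L (\<lambda>_. \<Sum>j\<in>A \<inter> I. x j)) = 0"
    using ij by (intro alternating_sum_Pow_eq_0[of _ j]) auto
  also have "(\<Sum>A\<in>Pow {..<n}. (-1) ^ card A * L (\<lambda>_. \<Sum>j\<in>A - I. x j)) = 0"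
    using ij by (intro alternating_sum_Pow_eq_0[of _ i]) auto
  finally show ?thesis using polarization by auto
qed

lemma diagonal_power:
  assumes "\<And>x k. k < n \<Longrightarrow> L (x(k := u)) = a * L (x(k := v))"
  shows "L (\<lambda>_. u) = a ^ n * L (\<lambda>_. v)"
proof -
  have "L (\<lambda>_. u) = a ^ m * L (\<lambda>k. if k < m then v else u)" if "m \<le> n" for m
    using that
  proof (induction m)
    case (Suc m)
    let ?x = "\<lambda>k. if k < m then v else u"
    have "?x = ?x(m := u)" "(\<lambda>k. if k < Suc m then v else u) = ?x(m := v)" by auto
    then show ?case using Suc assms[of m ?x] by (simp add: mult_ac)
  qed auto
  from this[of n] show ?thesis
    using slots_cong[of "\<lambda>k. if k < n then v else u" "\<lambda>_. v"] by simp
qed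

end

section \<open>Functions vanishing at infinity\<close>

lemma continuous_on_apply_c0: "continuous_on S (apply_c0 f)"
  using apply_c0[of f] by (auto intro: continuous_on_subset)

lemma c0_eqI: "(\<And>x. apply_c0 f x = apply_c0 g x) \<Longrightarrow> f = g"
  by (simp add: apply_c0_inject[symmetric] fun_eq_iff)

lemma apply_c0_sum: "apply_c0 (\<Sum>i\<in>A. f i) x = (\<Sum>i\<in>A. apply_c0 (f i) x)"
  by (induction A rule: infinite_finite_induct) (auto simp: zero_c0.rep_eq plus_c0.rep_eq)

definition supported_on :: "'a::topological_space c0 \<Rightarrow> 'a set \<Rightarrow> bool" where
  "supported_on f S \<longleftrightarrow> (\<forall>x. x \<notin> S \<longrightarrow> apply_c0 f x = 0)"

definition compactly_supported :: "'a::topological_space c0 \<Rightarrow> bool" where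
  "compactly_supported f \<longleftrightarrow> (\<exists>K. compact K \<and> supported_on f K)"

lemma supported_on_mono: "supported_on f S \<Longrightarrow> S \<subseteq> T \<Longrightarrow> supported_on f T"
  by (auto simp: supported_on_def)

lemma supported_on_sum: "(\<And>i. i \<in> A \<Longrightarrow> supported_on (f i) S) \<Longrightarrow> supported_on (\<Sum>i\<in>A. f i) S"
  by (auto simp: supported_on_def apply_c0_sum)

lemma mult_eq_0_if_disjoint_supports:
  "supported_on f S \<Longrightarrow> supported_on g T \<Longrightarrow> S \<inter> T = {} \<Longrightarrow> f * g = 0"
  by (intro c0_eqI) (auto simp: supported_on_def times_c0.rep_eq zero_c0.rep_eq)

definition multiplier :: "('a::topological_space \<Rightarrow> real) \<Rightarrow> 'a c0 \<Rightarrow> 'a c0" where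
  "multiplier g f = Abs_c0 (\<lambda>x. complex_of_real (g x) * apply_c0 f x)"

lemma apply_multiplier:
  assumes "continuous_on UNIV g" "\<And>x. \<bar>g x\<bar> \<le> C"
  shows "apply_c0 (multiplier g f) x = complex_of_real (g x) * apply_c0 f x"
proof -
  have "vanishes_at_infinity (apply_c0 f)"
    using apply_c0[of f] by simp
  then have "vanishes_at_infinity (\<lambda>x. complex_of_real (g x) * apply_c0 f x)"
    by (rule vanishes_at_infinity_bound[where C=C])
      (simp add: norm_mult mult_right_mono[OF assms(2)])
  moreover have "continuous_on UNIV (\<lambda>x. complex_of_real (g x) * apply_c0 f x)"
    by (intro continuous_intros assms(1) continuous_on_apply_c0)
  ultimately show ?thesis by (simp add: multiplier_def Abs_c0_inverse)
qed

lemma compact_superlevel_c0: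
  fixes f :: "'a::t2_space c0"
  assumes "e > 0"
  shows "compact {x. e \<le> cmod (apply_c0 f x)}"
proof -
  obtain K where K: "compact K" "\<And>x. x \<notin> K \<Longrightarrow> cmod (apply_c0 f x) < e"
    using apply_c0[of f] assms unfolding vanishes_at_infinity_def by blast
  have "closed {x. e \<le> cmod (apply_c0 f x)}"
    by (intro closed_Collect_le continuous_intros continuous_on_apply_c0)
  then have "compact (K \<inter> {x. e \<le> cmod (apply_c0 f x)})" using K(1) by blast
  also have "K \<inter> {x. e \<le> cmod (apply_c0 f x)} = {x. e \<le> cmod (apply_c0 f x)}"
    using K(2) by force
  finally show ?thesis .
qed

lemma c0_truncation:
  fixes f :: "'a::t2_space c0"
  assumes "e > 0"
  shows "\<exists>g. supported_on g {x. e \<le> cmod (apply_c0 f x)} \<and> norm (g - f) \<le> e"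
proof -
  define q where "q x = max 0 (cmod (apply_c0 f x) - e) / max e (cmod (apply_c0 f x))" for x
  have "max e (cmod (apply_c0 f x)) \<noteq> 0" for x using assms by (auto simp: max_def)
  then have q: "continuous_on UNIV q" "\<And>x. \<bar>q x\<bar> \<le> 1"
    unfolding q_def using assms
    by (auto intro!: continuous_intros continuous_on_apply_c0 simp: divide_simps)
  have app: "apply_c0 (multiplier q f) x = complex_of_real (q x) * apply_c0 f x" for x
    by (rule apply_multiplier[OF q])
  have "supported_on (multiplier q f) {x. e \<le> cmod (apply_c0 f x)}"
    by (auto simp: supported_on_def app q_def)
  moreover have "norm (multiplier q f - f) \<le> e"
  proof (rule norm_c0_le)
    fix x
    let ?a = "cmod (apply_c0 f x)"
    have "apply_c0 (multiplier q f - f) x = complex_of_real (q x - 1) * apply_c0 f x"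
      by (simp add: minus_c0.rep_eq app algebra_simps)
    then have "cmod (apply_c0 (multiplier q f - f) x) = \<bar>q x - 1\<bar> * ?a"
      by (simp only: norm_mult norm_of_real)
    also have "\<dots> = (1 - q x) * ?a" using q(2)[of x] by simp
    also have "\<dots> \<le> e"
    proof (cases "?a \<le> e")
      case True
      then show ?thesis by (simp add: q_def)
    next
      case False
      then have "?a \<noteq> 0" "q x = (?a - e) / ?a" using assms by (auto simp: q_def)
      then show ?thesis by (simp add: diff_divide_distrib)
    qed
    finally show "cmod (apply_c0 (multiplier q f - f) x) \<le> e" .
  qed
  ultimately show ?thesis by blast
qed

context
  assumes lc: "locally_compact_space (euclidean :: 'x::t2_space topology)"
begin

lemma urysohn_compact_open:
  fixes K U :: "'x set"
  assumes "compact K" "open U" "K \<subseteq> U"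
  obtains \<theta> :: "'x \<Rightarrow> real" where "continuous_on UNIV \<theta>" "\<And>x. 0 \<le> \<theta> x \<and> \<theta> x \<le> 1"
    "\<And>x. x \<in> K \<Longrightarrow> \<theta> x = 1" "\<And>x. x \<notin> U \<Longrightarrow> \<theta> x = 0"
proof -
  have "Hausdorff_space (euclidean :: 'x topology)"
    unfolding Hausdorff_space_def disjnt_def by (auto dest!: hausdorff)
  then have "completely_regular_space (euclidean :: 'x topology)"
    using lc locally_compact_regular_imp_completely_regular_space by blast
  then obtain \<theta> :: "'x \<Rightarrow> real" where
    "continuous_map euclidean (top_of_set {0..1}) \<theta>" "\<theta> ` (- U) \<subseteq> {0}" "\<theta> ` K \<subseteq> {1}"
    using assms Urysohn_completely_regular_compact_closed[of 0 1 euclidean K "- U"]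
    by (auto simp: disjnt_iff subset_iff)
  then show ?thesis
    by (intro that[of \<theta>]) (auto simp: continuous_map_in_subtopology image_subset_iff Pi_iff)
qed

lemma c0_bump:
  fixes a :: 'x
  assumes "open W" "a \<in> W"
  shows "\<exists>e. apply_c0 e a = 1 \<and> norm e \<le> 1 \<and> supported_on e W"
proof -
  obtain U K where UK: "open U" "compact K" "a \<in> U" "U \<subseteq> K"
    using lc by (auto simp: locally_compact_space_def) metis
  obtain \<theta> :: "'x \<Rightarrow> real" where \<theta>: "continuous_on UNIV \<theta>" "\<And>x. 0 \<le> \<theta> x \<and> \<theta> x \<le> 1"
      "\<theta> a = 1" "\<And>x. x \<notin> U \<inter> W \<Longrightarrow> \<theta> x = 0"
    using urysohn_compact_open[of "{a}" "U \<inter> W"] UK assms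
    by (metis IntI Int_iff compact_insert compact_empty open_Int
        empty_subsetI insert_subset singletonI)
  have "vanishes_at_infinity (\<lambda>x. complex_of_real (\<theta> x))"
    unfolding vanishes_at_infinity_def
  proof (intro allI impI exI[of _ K] conjI UK(2))
    fix d :: real and x assume "0 < d" "x \<notin> K"
    then have "\<theta> x = 0" using UK(4) \<theta>(4) by blast
    then show "cmod (complex_of_real (\<theta> x)) < d" using \<open>0 < d\<close> by simp
  qed
  moreover have "continuous_on UNIV (\<lambda>x. complex_of_real (\<theta> x))"
    by (intro continuous_intros \<theta>(1))
  ultimately have app: "apply_c0 (Abs_c0 (\<lambda>x. complex_of_real (\<theta> x))) x = complex_of_real (\<theta> x)" for x
    by (simp add: Abs_c0_inverse)
  show ?thesis
    using \<theta> by (intro exI[of _ "Abs_c0 (\<lambda>x. complex_of_real (\<theta> x))"])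
      (auto simp: supported_on_def app intro!: norm_c0_le)
qed

end

section \<open>Locality of orthogonally additive forms\<close>

locale orthogonally_additive_form = symmetric_additive_form n L
  for n :: nat and L :: "(nat \<Rightarrow> 'x::t2_space c0) \<Rightarrow> complex" +
  assumes locally_compact: "locally_compact_space (euclidean :: 'x topology)"
    and scale_slot: "i < n \<Longrightarrow> L (x(i := c *\<^sub>C u)) = c * L (x(i := u))"
    and bounded: "\<exists>C. \<forall>x. cmod (L x) \<le> C * (\<Prod>i<n. norm (x i))"
    and orth_add: "f * g = 0 \<Longrightarrow> L (\<lambda>_. f + g) = L (\<lambda>_. f) + L (\<lambda>_. g)"
begin

lemma zero_if_two_groups:
  assumes I: "I \<subseteq> {..<n}" "I \<noteq> {}" "I \<noteq> {..<n}" and "S \<inter> T = {}"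
    and S: "\<And>i. i \<in> I \<Longrightarrow> supported_on (x i) S"
    and T: "\<And>i. i \<in> {..<n} - I \<Longrightarrow> supported_on (x i) T"
  shows "L x = 0"
proof (rule zero_if_diagonal_splits[OF I])
  fix A assume A: "A \<subseteq> {..<n}"
  have "(\<Sum>j\<in>A \<inter> I. x j) * (\<Sum>j\<in>A - I. x j) = 0"
    using A S T by (intro mult_eq_0_if_disjoint_supports[OF _ _ \<open>S \<inter> T = {}\<close>] supported_on_sum) auto
  moreover have "(\<Sum>j\<in>A. x j) = (\<Sum>j\<in>A \<inter> I. x j) + (\<Sum>j\<in>A - I. x j)"
    using A finite_subset[of A "{..<n}"] by (intro sum.Int_Diff) auto
  ultimately show "L (\<lambda>_. \<Sum>j\<in>A. x j) = L (\<lambda>_. \<Sum>j\<in>A \<inter> I. x j) + L (\<lambda>_. \<Sum>j\<in>A - I. x j)"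
    by (simp add: orth_add)
qed

text \<open>Every factor outside the two groups is cut by a Urysohn function into a part that joins
  the first group and a part that joins the second.\<close>

lemma zero_if_two_groups_and_rest:
  assumes "finite R" "I \<union> J \<union> R = {..<n}" "I \<inter> J = {}" "I \<inter> R = {}" "J \<inter> R = {}"
    and "I \<noteq> {}" "J \<noteq> {}" "compact S" "compact T" "S \<inter> T = {}"
    and "\<And>i. i \<in> I \<Longrightarrow> supported_on (x i) S"
    and "\<And>i. i \<in> J \<Longrightarrow> supported_on (x i) T"
    and "\<And>i. i \<in> R \<Longrightarrow> compactly_supported (x i)"
  shows "L x = 0"
  using assms
proof (induction R arbitrary: I J S T x rule: finite_induct)
  case empty
  show ?case
    by (rule zero_if_two_groups[of I S T]) (use empty in blast)+
next
  case (insert i R)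
  note P = insert.prems
  have i: "i < n" "i \<notin> I" "i \<notin> J" using P by auto
  obtain K where K: "compact K" "supported_on (x i) K"
    using P(12)[of i] by (auto simp: compactly_supported_def)
  obtain \<theta> :: "'x \<Rightarrow> real" where \<theta>: "continuous_on UNIV \<theta>" "\<And>x. 0 \<le> \<theta> x \<and> \<theta> x \<le> 1"
      "\<And>x. x \<in> S \<Longrightarrow> \<theta> x = 1" "\<And>x. x \<notin> - T \<Longrightarrow> \<theta> x = 0"
  proof (rule urysohn_compact_open[OF locally_compact P(7)])
    show "open (- T)" using compact_imp_closed[OF P(8)] by auto
    show "S \<subseteq> - T" using P(9) by auto
  qed blast
  define q where "q x = min 1 (max 0 (3 * \<theta> x - 1))" for x
  have q: "continuous_on UNIV q" "\<And>x. \<bar>q x\<bar> \<le> 1"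
    by (auto simp: q_def intro!: continuous_intros \<theta>(1))
  have q': "continuous_on UNIV (\<lambda>x. 1 - q x)" "\<And>x. \<bar>1 - q x\<bar> \<le> 1"
    by (auto simp: q_def intro!: continuous_intros \<theta>(1))
  define u where "u = multiplier q (x i)"
  define v where "v = multiplier (\<lambda>x. 1 - q x) (x i)"
  have u: "apply_c0 u y = complex_of_real (q y) * apply_c0 (x i) y" for y
    unfolding u_def by (rule apply_multiplier[OF q])
  have v: "apply_c0 v y = complex_of_real (1 - q y) * apply_c0 (x i) y" for y
    unfolding v_def by (rule apply_multiplier[OF q'])
  define S' where "S' = S \<union> K \<inter> {y. 1/3 \<le> \<theta> y}"
  define T' where "T' = T \<union> K \<inter> {y. \<theta> y \<le> 2/3}"
  have "closed {y. 1/3 \<le> \<theta> y}" "closed {y. \<theta> y \<le> 2/3}"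
    by (intro closed_Collect_le continuous_intros \<theta>(1))+
  then have ST': "compact S'" "compact T'"
    unfolding S'_def T'_def using K(1) P(7,8) by (auto intro!: compact_Un)
  have disj: "S' \<inter> T = {}" "S \<inter> T' = {}"
    using P(9) \<theta>(3,4) by (auto simp: S'_def T'_def)
  have us: "supported_on u S'"
    using K(2) by (auto simp: supported_on_def S'_def u q_def)
  have vs: "supported_on v T'"
    using K(2) by (auto simp: supported_on_def T'_def v q_def)
  have "L (x(i := u)) = 0"
  proof (rule insert.IH[of "insert i I" J S' T])
    show "supported_on ((x(i := u)) k) S'" if "k \<in> insert i I" for k
      using that us P(10)[of k] supported_on_mono[of "x k" S S'] by (auto simp: S'_def)
    show "supported_on ((x(i := u)) k) T" if "k \<in> J" for k
      using that P(11)[of k] i by auto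
    show "compactly_supported ((x(i := u)) k)" if "k \<in> R" for k
      using that P(12)[of k] insert.hyps by auto
  qed (use P ST' disj insert.hyps in auto)
  moreover have "L (x(i := v)) = 0"
  proof (rule insert.IH[of I "insert i J" S T'])
    show "supported_on ((x(i := v)) k) T'" if "k \<in> insert i J" for k
      using that vs P(11)[of k] supported_on_mono[of "x k" T T'] by (auto simp: T'_def)
    show "supported_on ((x(i := v)) k) S" if "k \<in> I" for k
      using that P(10)[of k] i by auto
    show "compactly_supported ((x(i := v)) k)" if "k \<in> R" for k
      using that P(12)[of k] insert.hyps by auto
  qed (use P ST' disj insert.hyps in auto)
  moreover have "x i = u + v"
    by (intro c0_eqI) (simp add: plus_c0.rep_eq u v algebra_simps)
  ultimately show ?case
    using add_slot[OF i(1), of x u v] by (metis add_0 fun_upd_triv)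
qed

lemma zero_if_two_disjoint_slots:
  assumes "i < n" "j < n" "i \<noteq> j" "compact S" "compact T" "S \<inter> T = {}"
    and "supported_on (x i) S" "supported_on (x j) T"
    and "\<And>k. k < n \<Longrightarrow> compactly_supported (x k)"
  shows "L x = 0"
  using assms by (intro zero_if_two_groups_and_rest[of "{..<n} - {i, j}" "{i}" "{j}" S T]) auto

lemma zero_if_slot_in_null:
  assumes "i < n" "compact K" "K \<subseteq> U" "open U" "supported_on (x i) K"
    and null: "\<And>f. supported_on f U \<Longrightarrow> L (\<lambda>_. f) = 0"
    and cs: "\<And>k. k < n \<Longrightarrow> compactly_supported (x k)"
  shows "L x = 0"
proof -
  obtain \<theta> :: "'x \<Rightarrow> real" where \<theta>: "continuous_on UNIV \<theta>" "\<And>x. 0 \<le> \<theta> x \<and> \<theta> x \<le> 1"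
      "\<And>x. x \<in> K \<Longrightarrow> \<theta> x = 1" "\<And>x. x \<notin> U \<Longrightarrow> \<theta> x = 0"
    using urysohn_compact_open[OF locally_compact assms(2,4,3)] by blast
  define q where "q x = min 1 (3 * \<theta> x)" for x
  have "0 \<le> q x \<and> q x \<le> 1" for x using \<theta>(2)[of x] by (simp add: q_def)
  then have bounds: "\<bar>q x\<bar> \<le> 1" "\<bar>1 - q x\<bar> \<le> 1" for x by (simp_all add: abs_le_iff)
  have q: "continuous_on UNIV q"
    unfolding q_def by (intro continuous_intros \<theta>(1))
  then have q': "continuous_on UNIV (\<lambda>x. 1 - q x)" by (intro continuous_intros)
  define u where "u k = multiplier q (x k)" for k
  define v where "v k = multiplier (\<lambda>x. 1 - q x) (x k)" for k
  have u: "apply_c0 (u k) y = complex_of_real (q y) * apply_c0 (x k) y" for k y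
    unfolding u_def by (rule apply_multiplier[OF q bounds(1)])
  have v: "apply_c0 (v k) y = complex_of_real (1 - q y) * apply_c0 (x k) y" for k y
    unfolding v_def by (rule apply_multiplier[OF q' bounds(2)])
  have ucs: "compactly_supported (u k)" if "k < n" for k
    using cs[OF that] by (auto simp: compactly_supported_def supported_on_def u)
  have uU: "supported_on (u k) U" for k
    using \<theta>(4) by (auto simp: supported_on_def u q_def)
  let ?x = "\<lambda>m k. if k < m \<and> k \<noteq> i then u k else x k"
  have "L x = L (?x m)" if "m \<le> n" for m
    using that
  proof (induction m)
    case (Suc m)
    show ?case
    proof (cases "m = i")
      case True
      then have "?x (Suc m) = ?x m" by (auto simp: fun_eq_iff less_Suc_eq)
      then show ?thesis using Suc by (simp only:)
    next
      case False
      obtain M where M: "compact M" "supported_on (x m) M"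
        using cs[of m] Suc.prems by (auto simp: compactly_supported_def)
      have "closed {y. \<theta> y \<le> 1/3}"
        by (intro closed_Collect_le continuous_intros \<theta>(1))
      then have cM: "compact (M \<inter> {y. \<theta> y \<le> 1/3})" using M(1) by blast
      have vs: "supported_on (v m) (M \<inter> {y. \<theta> y \<le> 1/3})"
        using M(2) by (auto simp: supported_on_def v q_def)
      have v0: "L ((?x m)(m := v m)) = 0"
      proof (rule zero_if_two_disjoint_slots[of i m K "M \<inter> {y. \<theta> y \<le> 1/3}"])
        show "K \<inter> (M \<inter> {y. \<theta> y \<le> 1/3}) = {}" using \<theta>(3) by fastforce
        show "compactly_supported (((?x m)(m := v m)) k)" if "k < n" for k
          using cs[OF that] ucs[OF that] vs cM by (auto simp: compactly_supported_def)
      qed (use assms Suc.prems False cM vs in auto)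
      have xm: "x m = u m + v m"
        by (intro c0_eqI) (simp add: plus_c0.rep_eq u v algebra_simps)
      have "?x m = (?x m)(m := u m + v m)" "(?x m)(m := u m) = ?x (Suc m)"
        using False unfolding xm[symmetric] by (auto simp: fun_eq_iff less_Suc_eq)
      then have "L (?x m) = L (?x (Suc m))"
        using add_slot[of m "?x m" "u m" "v m"] Suc.prems v0 by simp
      then show ?thesis using Suc by simp
    qed
  qed auto
  then have "L x = L (?x n)" by blast
  also have "\<dots> = 0"
  proof (rule zero_if_diagonal_zero)
    fix A assume "A \<subseteq> {..<n}"
    then show "L (\<lambda>_. \<Sum>j\<in>A. ?x n j) = 0"
      using uU supported_on_mono[OF assms(5,3)]
      by (intro null supported_on_sum) auto
  qed
  finally show ?thesis .
qed

lemma zero_if_slot_locally_null: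
  assumes "i < n" "compact K" "supported_on (x i) K"
    and null: "\<And>a. a \<in> K \<Longrightarrow> \<exists>U. open U \<and> a \<in> U \<and> (\<forall>f. supported_on f U \<longrightarrow> L (\<lambda>_. f) = 0)"
    and cs: "\<And>k. k < n \<Longrightarrow> compactly_supported (x k)"
  shows "L x = 0"
proof -
  obtain U where U: "\<And>a. a \<in> K \<Longrightarrow> open (U a) \<and> a \<in> U a"
      "\<And>a f. a \<in> K \<Longrightarrow> supported_on f (U a) \<Longrightarrow> L (\<lambda>_. f) = 0"
    using null by metis
  have "\<exists>\<theta>::'x \<Rightarrow> real. continuous_on UNIV \<theta> \<and> (\<forall>x. 0 \<le> \<theta> x \<and> \<theta> x \<le> 1) \<and>
      \<theta> a = 1 \<and> (\<forall>x. x \<notin> U a \<longrightarrow> \<theta> x = 0)" if "a \<in> K" for a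
    by (rule urysohn_compact_open[OF locally_compact, of "{a}" "U a"]) (use U(1)[OF that] in auto)
  then obtain \<theta> :: "'x \<Rightarrow> 'x \<Rightarrow> real" where
    \<theta>: "\<And>a. a \<in> K \<Longrightarrow> continuous_on UNIV (\<theta> a)"
      "\<And>a y. a \<in> K \<Longrightarrow> 0 \<le> \<theta> a y \<and> \<theta> a y \<le> 1"
      "\<And>a. a \<in> K \<Longrightarrow> \<theta> a a = 1" "\<And>a y. a \<in> K \<Longrightarrow> y \<notin> U a \<Longrightarrow> \<theta> a y = 0"
    by metis
  obtain F where F: "F \<subseteq> K" "finite F" "K \<subseteq> (\<Union>a\<in>F. {y. 2/3 < \<theta> a y})"
  proof (rule compactE_image[OF assms(2), of K "\<lambda>a. {y. 2/3 < \<theta> a y}"])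
    show "open {y. 2/3 < \<theta> a y}" if "a \<in> K" for a
      by (intro open_Collect_less continuous_intros \<theta>(1) that)
    show "K \<subseteq> (\<Union>a\<in>K. {y. 2/3 < \<theta> a y})" using \<theta>(3) by force
  qed
  define g where "g a y = max 0 (3 * \<theta> a y - 1)" for a y
  define G where "G y = (\<Sum>a\<in>F. g a y)" for y
  have gc: "continuous_on UNIV (g a)" if "a \<in> F" for a
    unfolding g_def using that F(1) by (intro continuous_intros \<theta>(1)) auto
  have Gc: "continuous_on UNIV G"
    unfolding G_def by (intro continuous_intros gc)
  have g_nonneg: "0 \<le> g a y" for a y by (simp add: g_def)
  have G1: "1 \<le> G y" if "y \<in> K" for y
  proof -
    obtain a where a: "a \<in> F" "2/3 < \<theta> a y" using F(3) \<open>y \<in> K\<close> by blast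
    then have "1 \<le> g a y" by (simp add: g_def)
    also have "\<dots> \<le> G y" unfolding G_def using F(2) a(1) g_nonneg by (intro member_le_sum) auto
    finally show ?thesis .
  qed
  define q where "q a y = g a y / max 1 (G y)" for a y
  have q: "continuous_on UNIV (q a)" "\<bar>q a y\<bar> \<le> 2" if "a \<in> F" for a y
  proof -
    show "continuous_on UNIV (q a)"
      unfolding q_def by (intro continuous_intros gc that Gc) (auto simp: max_def)
    have "g a y \<le> 2" using \<theta>(2)[of a y] that F(1) by (auto simp: g_def)
    then have "g a y \<le> 2 * max 1 (G y)" by (simp add: max_def)
    then show "\<bar>q a y\<bar> \<le> 2" using g_nonneg[of a y] by (simp add: q_def pos_divide_le_eq)
  qed
  have app: "apply_c0 (multiplier (q a) (x i)) y = complex_of_real (q a y) * apply_c0 (x i) y"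
    if "a \<in> F" for a y by (rule apply_multiplier[OF q[OF that]])
  have "x i = (\<Sum>a\<in>F. multiplier (q a) (x i))"
  proof (rule c0_eqI)
    fix y
    show "apply_c0 (x i) y = apply_c0 (\<Sum>a\<in>F. multiplier (q a) (x i)) y"
    proof (cases "y \<in> K")
      case True
      have "(\<Sum>a\<in>F. q a y) = G y / max 1 (G y)"
        by (simp add: q_def G_def sum_divide_distrib)
      then have "(\<Sum>a\<in>F. q a y) = 1" using G1[OF True] by (simp add: max_def)
      then show ?thesis
        by (simp add: apply_c0_sum app sum_distrib_right[symmetric] of_real_sum[symmetric])
    next
      case False
      then have "apply_c0 (x i) y = 0" using assms(3) by (simp add: supported_on_def)
      then show ?thesis by (simp add: apply_c0_sum app)
    qed
  qed
  then have "L x = L (x(i := \<Sum>a\<in>F. multiplier (q a) (x i)))"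
    by (metis fun_upd_triv)
  also have "\<dots> = (\<Sum>a\<in>F. L (x(i := multiplier (q a) (x i))))"
    using F(2) assms(1) by (rule sum_slot)
  also have "\<dots> = 0"
  proof (rule sum.neutral, rule ballI)
    fix a assume a: "a \<in> F"
    then have aK: "a \<in> K" using F(1) by auto
    let ?M = "K \<inter> {y. 1/3 \<le> \<theta> a y}"
    have "closed {y. 1/3 \<le> \<theta> a y}"
      by (intro closed_Collect_le continuous_intros \<theta>(1) aK)
    then have cM: "compact ?M" using assms(2) by blast
    have supp: "supported_on (multiplier (q a) (x i)) ?M"
      using assms(3) by (auto simp: supported_on_def app[OF a] q_def g_def)
    show "L (x(i := multiplier (q a) (x i))) = 0"
    proof (rule zero_if_slot_in_null[of i ?M "U a"])
      show "?M \<subseteq> U a" using \<theta>(4)[OF aK] by force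
      show "compactly_supported ((x(i := multiplier (q a) (x i))) k)" if "k < n" for k
        using cs[OF that] cM supp by (auto simp: compactly_supported_def)
    qed (use assms(1) cM U aK supp in auto)
  qed
  finally show ?thesis .
qed

lemma zero_slot_approx:
  assumes "i < n" and approx: "\<And>e. e > 0 \<Longrightarrow> \<exists>v. norm (v - x i) \<le> e \<and> L (x(i := v)) = 0"
  shows "L x = 0"
proof -
  obtain C where C: "\<And>x. cmod (L x) \<le> C * (\<Prod>k<n. norm (x k))" using bounded by blast
  define B where "B = \<bar>C\<bar> * (\<Prod>k\<in>{..<n} - {i}. norm (x k))"
  have B: "0 \<le> B" by (auto simp: B_def intro!: mult_nonneg_nonneg prod_nonneg)
  have le: "cmod (L x) \<le> B * e" if e: "e > 0" for e
  proof -
    obtain v where v: "norm (v - x i) \<le> e" "L (x(i := v)) = 0" using approx[OF e] by blast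
    have "L (x(i := v)) = L (x(i := v - x i)) + L (x(i := x i))"
      using add_slot[OF assms(1), of x "v - x i" "x i"] by simp
    then have "cmod (L x) = cmod (L (x(i := v - x i)))"
      using v(2) by (simp add: add_eq_0_iff)
    also have "\<dots> \<le> C * (\<Prod>k<n. norm ((x(i := v - x i)) k))" by (rule C)
    also have "(\<Prod>k<n. norm ((x(i := v - x i)) k))
        = norm (v - x i) * (\<Prod>k\<in>{..<n} - {i}. norm (x k))"
      using assms(1) by (subst prod.remove[of _ i]) (auto intro!: prod.cong)
    also have "C * \<dots> \<le> \<bar>C\<bar> * \<dots>" by (intro mult_right_mono) (auto intro!: prod_nonneg mult_nonneg_nonneg)
    also have "\<dots> = B * norm (v - x i)" by (simp add: B_def)
    also have "\<dots> \<le> B * e" using v(1) B by (rule mult_left_mono)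
    finally show ?thesis .
  qed
  have "cmod (L x) \<le> 0 + e" if "e > 0" for e
  proof -
    have "cmod (L x) \<le> B * (e / (B + 1))" using that B by (intro le) auto
    also have "\<dots> \<le> e" using that B by (simp add: field_simps)
    finally show ?thesis by simp
  qed
  then have "cmod (L x) \<le> 0" by (rule field_le_epsilon)
  then show ?thesis by simp
qed

lemma zero_if_slot_vanishes_on_nonnull:
  assumes "i < n"
    and null: "\<And>a. apply_c0 (x i) a \<noteq> 0 \<Longrightarrow>
      \<exists>U. open U \<and> a \<in> U \<and> (\<forall>f. supported_on f U \<longrightarrow> L (\<lambda>_. f) = 0)"
  shows "L x = 0"
proof -
  have "L x = 0" if "\<And>k. k < n \<Longrightarrow> m \<le> k \<Longrightarrow> k \<noteq> i \<Longrightarrow> compactly_supported (x k)"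
      "\<And>a. apply_c0 (x i) a \<noteq> 0 \<Longrightarrow>
        \<exists>U. open U \<and> a \<in> U \<and> (\<forall>f. supported_on f U \<longrightarrow> L (\<lambda>_. f) = 0)" "m \<le> n" for m x
    using that
  proof (induction m arbitrary: x)
    case 0
    show ?case
    proof (rule zero_slot_approx[OF assms(1)])
      fix e :: real assume e: "e > 0"
      let ?K = "{y. e \<le> cmod (apply_c0 (x i) y)}"
      obtain v where v: "supported_on v ?K" "norm (v - x i) \<le> e"
        using c0_truncation[OF e] by blast
      have K: "compact ?K" by (rule compact_superlevel_c0[OF e])
      have "L (x(i := v)) = 0"
      proof (rule zero_if_slot_locally_null[OF assms(1) K])
        show "compactly_supported ((x(i := v)) k)" if "k < n" for k
          using 0(1)[OF that] v(1) K by (auto simp: compactly_supported_def)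
        show "\<exists>U. open U \<and> a \<in> U \<and> (\<forall>f. supported_on f U \<longrightarrow> L (\<lambda>_. f) = 0)"
          if "a \<in> ?K" for a
          using that e by (intro 0(2)) auto
      qed (use v in auto)
      then show "\<exists>v. norm (v - x i) \<le> e \<and> L (x(i := v)) = 0" using v(2) by blast
    qed
  next
    case (Suc m)
    show ?case
    proof (cases "m = i")
      case True
      then show ?thesis using Suc.prems by (intro Suc.IH) auto
    next
      case False
      show ?thesis
      proof (rule zero_slot_approx[of m])
        fix e :: real assume e: "e > 0"
        obtain v where v: "supported_on v {y. e \<le> cmod (apply_c0 (x m) y)}" "norm (v - x m) \<le> e"
          using c0_truncation[OF e] by blast
        then have "compactly_supported v"
          using compact_superlevel_c0[OF e] by (auto simp: compactly_supported_def)
        then have "L (x(m := v)) = 0"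
          using Suc.prems False by (intro Suc.IH) (auto simp: Suc_le_eq)
        then show "\<exists>v. norm (v - x m) \<le> e \<and> L (x(m := v)) = 0" using v(2) by blast
      qed (use Suc.prems in auto)
    qed
  qed
  from this[of n] show ?thesis using null by auto
qed

lemma evaluation_power:
  assumes "apply_c0 e a = 1"
    and "\<And>b. b \<noteq> a \<Longrightarrow> \<exists>U. open U \<and> b \<in> U \<and> (\<forall>f. supported_on f U \<longrightarrow> L (\<lambda>_. f) = 0)"
  shows "L (\<lambda>_. f) = apply_c0 f a ^ n * L (\<lambda>_. e)"
proof (rule diagonal_power)
  fix x k assume k: "k < n"
  let ?g = "f - apply_c0 f a *\<^sub>C e"
  have "apply_c0 ?g a = 0" using assms(1) by (simp add: minus_c0.rep_eq scaleC_c0.rep_eq)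
  then have "L (x(k := ?g)) = 0"
    using k assms(2) by (intro zero_if_slot_vanishes_on_nonnull[of k]) (auto, metis)
  moreover have "L (x(k := ?g + apply_c0 f a *\<^sub>C e))
      = L (x(k := ?g)) + L (x(k := apply_c0 f a *\<^sub>C e))"
    by (rule add_slot[OF k])
  ultimately show "L (x(k := f)) = apply_c0 f a * L (x(k := e))"
    using scale_slot[OF k] by simp
qed

end

section \<open>The representation\<close>

theorem theorem3p3:
  fixes H :: "'x::t2_space c0 \<Rightarrow> 'y::t2_space c0" and r :: real
  assumes "locally_compact_space (euclidean :: 'x topology)"
    and "locally_compact_space (euclidean :: 'y topology)"
    and "r > 0"
    and "bounded (H ` ball 0 r)"
    and "orthogonally_additive_on (ball 0 r) H"
    and "zero_product_preserving_on (ball 0 r) H"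
    and "holomorphic_on_zero_ball r H"
  shows "\<exists>(h :: nat \<Rightarrow> 'y \<Rightarrow> complex) (\<phi> :: 'y \<Rightarrow> 'x).
           (\<forall>n\<ge>1. bounded (range (h n)) \<and> open {y. h n y \<noteq> 0} \<and>
                   continuous_on {y. h n y \<noteq> 0} (h n)) \<and>
           uniform_limit (ball 0 r \<times> UNIV)
             (\<lambda>N (f, y). \<Sum>n=1..N. h n y * (apply_c0 f (\<phi> y)) ^ n)
             (\<lambda>(f, y). apply_c0 (H f) y) sequentially \<and>
           continuous_on (\<Union>n\<in>{1..}. {y. h n y \<noteq> 0}) \<phi>"
proof -
  obtain P where P: "\<And>n. bounded_homogeneous_polynomial n (P n)"
      "uniform_limit (ball 0 r) (\<lambda>N x. \<Sum>n\<le>N. P n x) H sequentially"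
    using assms(7) unfolding holomorphic_on_zero_ball_def by blast
  obtain Q where Q: "\<And>n. bounded_symmetric_multilinear n (Q n)" "\<And>n x. P n x = Q n (\<lambda>_. x)"
    using P(1) unfolding bounded_homogeneous_polynomial_def by metis
  define F where "F n y x = apply_c0 (Q n x) y" for n y x
  define p where "p n y f = apply_c0 (P n f) y" for n y f
  have pF: "p n y f = F n y (\<lambda>_. f)" for n y f by (simp add: p_def F_def Q(2))

  have Q_scale: "Q n (x(i := c *\<^sub>C u)) = c *\<^sub>C Q n (x(i := u))" if "i < n" for n i x c u
    using Q(1)[of n] that unfolding bounded_symmetric_multilinear_def by blast
  have F_scale: "F n y (x(i := c *\<^sub>C u)) = c * F n y (x(i := u))" if "i < n" for n y i x c u
    by (simp add: F_def Q_scale[OF that] scaleC_c0.rep_eq)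
  have saf: "symmetric_additive_form n (F n y)" for n y
  proof
    show "F n y x = F n y z" if "\<And>i. i < n \<Longrightarrow> x i = z i" for x z
      using Q(1)[of n] that unfolding bounded_symmetric_multilinear_def F_def by metis
    show "F n y (x(i := u + v)) = F n y (x(i := u)) + F n y (x(i := v))" if "i < n" for i x u v
      using Q(1)[of n] that unfolding bounded_symmetric_multilinear_def F_def
      by (simp add: plus_c0.rep_eq)
    show "F n y (x \<circ> \<pi>) = F n y x" if "\<pi> permutes {..<n}" for \<pi> x
      using Q(1)[of n] that unfolding bounded_symmetric_multilinear_def F_def by simp
  qed
  have "\<exists>C. \<forall>x. norm (Q n x) \<le> C * (\<Prod>i<n. norm (x i))" for n
    using Q(1)[of n] unfolding bounded_symmetric_multilinear_def by blast
  then obtain C where C: "\<And>n x. norm (Q n x) \<le> C n * (\<Prod>i<n. norm (x i))" by metis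
  have F_bound: "cmod (F n y x) \<le> C n * (\<Prod>i<n. norm (x i))" for n y x
    using order_trans[OF norm_apply_c0_le C] by (simp add: F_def)
  have hom: "p n y (c *\<^sub>C f) = c ^ n * p n y f" for n y c f
    unfolding pF by (rule symmetric_additive_form.diagonal_power[OF saf]) (rule F_scale)

  have unif: "uniform_limit (ball 0 r \<times> UNIV) (\<lambda>N (f, y). \<Sum>n\<le>N. p n y f)
      (\<lambda>(f, y). apply_c0 (H f) y) sequentially"
  proof (rule uniform_limitI)
    fix e :: real assume "e > 0"
    from uniform_limitD[OF P(2) this]
    show "\<forall>\<^sub>F N in sequentially. \<forall>z\<in>ball 0 r \<times> UNIV.
        dist (case z of (f, y) \<Rightarrow> \<Sum>n\<le>N. p n y f) (case z of (f, y) \<Rightarrow> apply_c0 (H f) y) < e"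
    proof eventually_elim
      case (elim N)
      show ?case
      proof clarify
        fix f y assume "f \<in> ball (0 :: 'x c0) r"
        then have "norm ((\<Sum>n\<le>N. P n f) - H f) < e" using elim by (simp add: dist_norm)
        then show "dist (\<Sum>n\<le>N. p n y f) (apply_c0 (H f) y) < e"
          using norm_apply_c0_le[of "(\<Sum>n\<le>N. P n f) - H f" y]
          by (simp add: dist_norm p_def minus_c0.rep_eq apply_c0_sum)
      qed
    qed
  qed
  have sums: "(\<lambda>n. p n y f * t ^ n) sums apply_c0 (H (t *\<^sub>C f)) y"
    if "norm f < r" "norm t \<le> 1" for f y t
  proof -
    have "norm (t *\<^sub>C f) < r"
      using that mult_right_mono[OF that(2) norm_ge_zero[of f]] by (simp add: norm_scaleC)
    then have "(t *\<^sub>C f, y) \<in> ball 0 r \<times> UNIV" by simp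
    from tendsto_uniform_limitI[OF unif this]
    show ?thesis by (simp add: sums_def_le hom mult.commute)
  qed

  have shrink: "\<exists>c. c \<noteq> 0 \<and> norm (c *\<^sub>C f) < r / 2 \<and> norm (c *\<^sub>C g) < r / 2" for f g :: "'x c0"
  proof -
    define M where "M = 1 + norm f + norm g"
    have M: "M > 0" "norm f < M" "norm g < M"
      unfolding M_def using norm_ge_zero[of f] norm_ge_zero[of g] by linarith+
    define d where "d = r / (2 * M)"
    have d: "d > 0" "d * M = r / 2" using M(1) assms(3) by (auto simp: d_def)
    have "d * norm f < r / 2" "d * norm g < r / 2"
      unfolding d(2)[symmetric] using d(1) M by (auto intro!: mult_strict_left_mono)
    then show ?thesis
      using d by (intro exI[of _ "complex_of_real d"]) (auto simp: norm_scaleC)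
  qed
  have mult_scale: "(s *\<^sub>C f) * (t *\<^sub>C g) = 0" if "f * g = 0" for s t and f g :: "'x c0"
  proof -
    have "(s *\<^sub>C f) * (t *\<^sub>C g) = (s * t) *\<^sub>C (f * g)"
      by (intro c0_eqI) (simp add: times_c0.rep_eq scaleC_c0.rep_eq)
    also have "\<dots> = 0" using that by (intro c0_eqI) (simp add: zero_c0.rep_eq scaleC_c0.rep_eq)
    finally show ?thesis .
  qed
  have p_add: "p n y (f + g) = p n y f + p n y g" if fg: "f * g = 0" for n y f g
  proof -
    have small: "p n y (f + g) = p n y f + p n y g"
      if fg: "f * g = 0" and f: "norm f < r / 2" and g: "norm g < r / 2" for f g
    proof -
      have nf: "norm f < r" "norm g < r" "norm (f + g) < r"
        using f g assms(3) norm_triangle_ineq[of f g] by linarith+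
      have "p n y (f + g) - p n y f - p n y g = 0"
      proof (rule power_series_coeff_zero[of "\<lambda>n. p n y (f + g) - p n y f - p n y g"])
        fix t :: complex assume t: "norm t \<le> 1"
        have le: "norm (t *\<^sub>C u) \<le> norm u" for u :: "'x c0"
          using mult_right_mono[OF t norm_ge_zero[of u]] by (simp add: norm_scaleC)
        have "H (t *\<^sub>C (f + g)) = H (t *\<^sub>C f) + H (t *\<^sub>C g)"
          unfolding scaleC_add_right
        proof (rule assms(5)[unfolded orthogonally_additive_on_def, rule_format])
          show "t *\<^sub>C f + t *\<^sub>C g \<in> ball 0 r"
            using le[of "f + g"] nf by (simp add: scaleC_add_right)
        qed (use le[of f] le[of g] nf mult_scale[OF fg] in \<open>auto simp: mult.commute\<close>)
        then have "apply_c0 (H (t *\<^sub>C (f + g))) y - apply_c0 (H (t *\<^sub>C f)) y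
            - apply_c0 (H (t *\<^sub>C g)) y = 0" by (simp add: plus_c0.rep_eq)
        then show "(\<lambda>n. (p n y (f + g) - p n y f - p n y g) * t ^ n) sums 0"
          using sums_diff[OF sums_diff[OF sums[OF nf(3) t, of y] sums[OF nf(1) t, of y]]
              sums[OF nf(2) t, of y]]
          by (simp add: algebra_simps)
      qed
      then show ?thesis by (simp add: algebra_simps)
    qed
    obtain c where c: "c \<noteq> 0" "norm (c *\<^sub>C f) < r / 2" "norm (c *\<^sub>C g) < r / 2"
      using shrink by blast
    have "c ^ n * p n y (f + g) = c ^ n * (p n y f + p n y g)"
      using small[OF mult_scale[OF fg] c(2,3)]
      by (simp add: scaleC_add_right[symmetric] hom distrib_left)
    then show ?thesis using c(1) by simp
  qed
  have p_zero_product: "p m y f = 0 \<or> p n y g = 0" if fg: "f * g = 0" for m n y f g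
  proof -
    obtain c where c: "c \<noteq> 0" "norm (c *\<^sub>C f) < r / 2" "norm (c *\<^sub>C g) < r / 2"
      using shrink by blast
    define f' g' where "f' = c *\<^sub>C f" and "g' = c *\<^sub>C g"
    have nf: "norm f' < r" "norm g' < r" using c assms(3) by (auto simp: f'_def g'_def)
    have prod: "apply_c0 (H (s *\<^sub>C f')) y * apply_c0 (H (t *\<^sub>C g')) y = 0"
      if "norm s \<le> 1" "norm t \<le> 1" for s t
    proof -
      have "norm (s *\<^sub>C f') \<le> norm f'" "norm (t *\<^sub>C g') \<le> norm g'"
        using mult_right_mono[OF that(1) norm_ge_zero[of f']]
          mult_right_mono[OF that(2) norm_ge_zero[of g']] by (auto simp: norm_scaleC)
      moreover have "(s *\<^sub>C f') * (t *\<^sub>C g') = 0"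
        unfolding f'_def g'_def by (intro mult_scale fg)
      ultimately have "H (s *\<^sub>C f') * H (t *\<^sub>C g') = 0"
        using assms(6) nf unfolding zero_product_preserving_on_def by auto
      then show ?thesis by (metis times_c0.rep_eq zero_c0.rep_eq)
    qed
    show ?thesis
    proof (cases "\<forall>t. norm t \<le> 1 \<longrightarrow> apply_c0 (H (t *\<^sub>C g')) y = 0")
      case True
      then have "p n y g' = 0"
        using sums[OF nf(2), of _ y] by (intro power_series_coeff_zero) metis
      then show ?thesis using c(1) by (simp add: g'_def hom)
    next
      case False
      then have "apply_c0 (H (t *\<^sub>C f')) y = 0" if "norm t \<le> 1" for t
        using prod[OF that] by auto
      then have "p m y f' = 0"
        using sums[OF nf(1), of _ y] by (intro power_series_coeff_zero) metis
      then show ?thesis using c(1) by (simp add: f'_def hom)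
    qed
  qed
  have p0: "p 0 y f = 0" for y f
  proof -
    have "p 0 y f = p 0 y 0" unfolding pF by (rule symmetric_additive_form.slots_cong[OF saf]) simp
    then show ?thesis using p_add[of 0 0 0 y] by simp
  qed

  have oaf: "orthogonally_additive_form n (F n y)" for n y
    unfolding orthogonally_additive_form_def orthogonally_additive_form_axioms_def
  proof (intro conjI allI impI)
    show "symmetric_additive_form n (F n y)" by (rule saf)
    show "locally_compact_space (euclidean :: 'x topology)" by (rule assms(1))
    show "F n y (x(i := c *\<^sub>C u)) = c * F n y (x(i := u))" if "i < n" for i x c u
      by (rule F_scale[OF that])
    show "\<exists>C. \<forall>x. cmod (F n y x) \<le> C * (\<Prod>i<n. norm (x i))"
      using F_bound by blast
    show "F n y (\<lambda>_. f + g) = F n y (\<lambda>_. f) + F n y (\<lambda>_. g)" if "f * g = 0" for f g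
      using p_add[OF that] unfolding pF .
  qed

  define null where "null y b \<longleftrightarrow> (\<exists>U. open U \<and> b \<in> U \<and> (\<forall>f. supported_on f U \<longrightarrow> (\<forall>n. p n y f = 0)))"
    for y b
  have "\<exists>a. \<forall>b. b \<noteq> a \<longrightarrow> null y b" for y
  proof (rule ccontr)
    assume no: "\<nexists>a. \<forall>b. b \<noteq> a \<longrightarrow> null y b"
    then obtain a where a: "\<not> null y a" by blast
    from no obtain b where b: "\<not> null y b" "b \<noteq> a" by blast
    obtain U V where UV: "open U" "open V" "a \<in> U" "b \<in> V" "U \<inter> V = {}"
      using hausdorff[OF b(2)[symmetric]] by blast
    obtain f m where f: "supported_on f U" "p m y f \<noteq> 0" using a UV by (auto simp: null_def)
    obtain g n where g: "supported_on g V" "p n y g \<noteq> 0" using b UV by (auto simp: null_def)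
    show False
      using p_zero_product[OF mult_eq_0_if_disjoint_supports[OF f(1) g(1) UV(5)]] f g by blast
  qed
  then obtain \<phi> where \<phi>: "\<And>y b. b \<noteq> \<phi> y \<Longrightarrow> null y b" by metis
  obtain e where e: "\<And>a::'x. apply_c0 (e a) a = 1" "\<And>a. norm (e a) \<le> 1"
    using c0_bump[OF assms(1) open_UNIV UNIV_I] by metis
  define h where "h n y = p n y (e (\<phi> y))" for n y
  have rep: "p n y f = h n y * apply_c0 f (\<phi> y) ^ n" for n y f
  proof -
    have "p n y f = apply_c0 f (\<phi> y) ^ n * h n y"
      unfolding h_def pF
    proof (rule orthogonally_additive_form.evaluation_power[OF oaf e(1)])
      fix b assume "b \<noteq> \<phi> y"
      then have "null y b" by (rule \<phi>)
      then obtain U where "open U" "b \<in> U" "\<And>f. supported_on f U \<Longrightarrow> p n y f = 0"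
        unfolding null_def by auto
      then show "\<exists>U. open U \<and> b \<in> U \<and> (\<forall>f. supported_on f U \<longrightarrow> F n y (\<lambda>_. f) = 0)"
        by (auto simp: pF)
    qed
    then show ?thesis by (simp add: mult.commute)
  qed

  have nbhd: "\<exists>V f. open V \<and> y \<in> V \<and>
      (\<forall>z\<in>V. \<phi> z \<in> W \<and> apply_c0 f (\<phi> z) \<noteq> 0 \<and> h n z \<noteq> 0)"
    if "n \<ge> 1" "h n y \<noteq> 0" and W: "open W" "\<phi> y \<in> W" for n y W
  proof -
    obtain f where f: "apply_c0 f (\<phi> y) = 1" "supported_on f W"
      using c0_bump[OF assms(1) W] by blast
    define V where "V = {z. apply_c0 (P n f) z \<noteq> 0}"
    have "open V"
      unfolding V_def by (intro open_Collect_neq continuous_on_apply_c0 continuous_on_const)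
    moreover have "y \<in> V" using rep[of n y f] f(1) that(2) by (simp add: V_def p_def)
    moreover have "\<phi> z \<in> W \<and> apply_c0 f (\<phi> z) \<noteq> 0 \<and> h n z \<noteq> 0" if "z \<in> V" for z
    proof -
      have "h n z * apply_c0 f (\<phi> z) ^ n \<noteq> 0" using that rep[of n z f] by (simp add: V_def p_def)
      then have "h n z \<noteq> 0" "apply_c0 f (\<phi> z) \<noteq> 0" using \<open>n \<ge> 1\<close> by auto
      then show ?thesis using f(2) by (auto simp: supported_on_def)
    qed
    ultimately show ?thesis by blast
  qed
  have \<phi>_cont: "continuous_on (\<Union>n\<in>{1..}. {y. h n y \<noteq> 0}) \<phi>"
    unfolding continuous_on_topological
  proof (intro ballI allI impI)
    fix y W assume "y \<in> (\<Union>n\<in>{1..}. {y. h n y \<noteq> 0})" "open W" "\<phi> y \<in> W"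
    then obtain n where "n \<ge> 1" "h n y \<noteq> 0" by auto
    from nbhd[OF this \<open>open W\<close> \<open>\<phi> y \<in> W\<close>]
    show "\<exists>V. open V \<and> y \<in> V \<and> (\<forall>z\<in>\<Union>n\<in>{1..}. {y. h n y \<noteq> 0}. z \<in> V \<longrightarrow> \<phi> z \<in> W)" by blast
  qed
  have h_bounded: "bounded (range (h n))" for n
  proof -
    have "cmod (h n y) \<le> \<bar>C n\<bar>" for y
    proof -
      have prod: "0 \<le> (\<Prod>i<n. norm (e (\<phi> y)))" "(\<Prod>i<n. norm (e (\<phi> y))) \<le> 1"
        using e(2) by (simp_all add: power_le_one)
      have "cmod (h n y) \<le> C n * (\<Prod>i<n. norm (e (\<phi> y)))"
        unfolding h_def pF by (rule F_bound)
      also have "\<dots> \<le> \<bar>C n\<bar> * (\<Prod>i<n. norm (e (\<phi> y)))"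
        using prod(1) by (intro mult_right_mono) auto
      also have "\<dots> \<le> \<bar>C n\<bar>" using prod by (intro mult_left_le) auto
      finally show ?thesis .
    qed
    then show ?thesis by (auto simp: bounded_iff)
  qed
  have h_open: "open {y. h n y \<noteq> 0}" if "n \<ge> 1" for n
  proof (subst open_subopen, intro ballI)
    fix y assume "y \<in> {y. h n y \<noteq> 0}"
    then show "\<exists>T. open T \<and> y \<in> T \<and> T \<subseteq> {y. h n y \<noteq> 0}"
      using nbhd[OF that, of y UNIV] by auto
  qed
  have h_cont: "continuous_on {y. h n y \<noteq> 0} (h n)" if n: "n \<ge> 1" for n
  proof (rule continuous_at_imp_continuous_on, rule ballI)
    fix y assume "y \<in> {y. h n y \<noteq> 0}"
    then obtain V f where V: "open V" "y \<in> V"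
        "\<And>z. z \<in> V \<Longrightarrow> apply_c0 f (\<phi> z) \<noteq> 0" "\<And>z. z \<in> V \<Longrightarrow> h n z \<noteq> 0"
      using nbhd[OF n, of y UNIV] by auto
    have "continuous_on V \<phi>"
      using V(4) n by (intro continuous_on_subset[OF \<phi>_cont]) auto
    then have "continuous_on V (\<lambda>z. apply_c0 f (\<phi> z))"
      by (rule continuous_on_compose2[OF continuous_on_apply_c0[of UNIV]]) auto
    then have "continuous_on V (\<lambda>z. apply_c0 (P n f) z / apply_c0 f (\<phi> z) ^ n)"
      using V(3) by (intro continuous_intros continuous_on_apply_c0) auto
    moreover have "apply_c0 (P n f) z / apply_c0 f (\<phi> z) ^ n = h n z" if "z \<in> V" for z
      using rep[of n z f] V(3)[OF that] by (simp add: p_def)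
    ultimately have "continuous_on V (h n)" by (simp cong: continuous_on_cong)
    then show "isCont (h n) y" using V by (simp add: continuous_on_eq_continuous_at)
  qed
  have "(\<Sum>n=1..N. h n y * apply_c0 f (\<phi> y) ^ n) = (\<Sum>n\<le>N. p n y f)" for N f y
  proof -
    have "(\<Sum>n\<in>{1..N}. p n y f) = (\<Sum>n\<le>N. p n y f)"
      using p0 by (intro sum.mono_neutral_left) (auto simp: Suc_le_eq)
    then show ?thesis by (simp add: rep)
  qed
  then have "uniform_limit (ball 0 r \<times> UNIV)
      (\<lambda>N (f, y). \<Sum>n=1..N. h n y * (apply_c0 f (\<phi> y)) ^ n)
      (\<lambda>(f, y). apply_c0 (H f) y) sequentially"
    using unif by simp
  then show ?thesis using h_bounded h_open h_cont \<phi>_cont by blast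
qed

end
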